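(* Let $\mathscr{C}:S^1\to\mathbb{R}^2$ be a plane curve and let $\mathfrak{G}$ be its Gauss diagram; assume that $\mathfrak{c}_\times\neq\varnothing$ for every chord $\mathfrak{c}$ of $\mathfrak{G}$. Then (1) $|\mathfrak{a}_\times\cap\mathfrak{b}_\times|\equiv 0 \pmod 2$ for every two non-intersecting chords $\mathfrak{a},\mathfrak{b}$ of $\mathfrak{G}$; (2) $|\mathfrak{c}_\times|\equiv 0\pmod 2$ for every chord $\mathfrak{c}$ of $\mathfrak{G}$.
   Context: A plane curve is a generic immersion $S^1\to\mathbb{R}^2$, i.e. an immersion all of whose multiple points are transversal double points. Its Gauss diagram is the circle $S^1$ with the two preimages of each double point joined by a chord. Two distinct chords intersect (cross) if their endpoints alternate along the circle. For a chord $\mathfrak{c}$, $\mathfrak{c}_\times$ denotes the set of all chords that cross $\mathfrak{c}$ (so $\mathfrak{c}\notin\mathfrak{c}_\times$). *)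

theory Defs
  imports "HOL-Analysis.Analysis"
begin

abbreviation circle :: "complex set" where
  "circle \<equiv> sphere 0 1"

text \<open>A map on the circle is handled through its lift along the covering \<open>t \<mapsto> cis t\<close>, which is
  a local diffeomorphism; the lift determines the map on the circle, and values off the circle are
  never used. Immersions are only required to be of class \<open>C\<^sup>1\<close>.\<close>

definition lift :: "(complex \<Rightarrow> real^2) \<Rightarrow> real \<Rightarrow> real^2" where
  "lift C t = C (cis t)"

definition velocity :: "(complex \<Rightarrow> real^2) \<Rightarrow> real \<Rightarrow> real^2" where
  "velocity C t = vector_derivative (lift C) (at t)"

definition immersion :: "(complex \<Rightarrow> real^2) \<Rightarrow> bool" where
  "immersion C \<longleftrightarrow> lift C C1_differentiable_on UNIV \<and> (\<forall>t. velocity C t \<noteq> 0)"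

definition fibre :: "(complex \<Rightarrow> real^2) \<Rightarrow> real^2 \<Rightarrow> complex set" where
  "fibre C x = {p \<in> circle. C p = x}"

definition multiple_point :: "(complex \<Rightarrow> real^2) \<Rightarrow> real^2 \<Rightarrow> bool" where
  "multiple_point C x \<longleftrightarrow> (\<exists>p\<in>fibre C x. \<exists>q\<in>fibre C x. p \<noteq> q)"

text \<open>Transversality is expressed by a span: linear independence of the set of the two velocities
  would wrongly hold when they coincide.\<close>

definition transversal_double_point :: "(complex \<Rightarrow> real^2) \<Rightarrow> real^2 \<Rightarrow> bool" where
  "transversal_double_point C x \<longleftrightarrow>
     card (fibre C x) = 2 \<and>
     (\<forall>s t. cis s \<in> fibre C x \<longrightarrow> cis t \<in> fibre C x \<longrightarrow> cis s \<noteq> cis t \<longrightarrow>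
        span {velocity C s, velocity C t} = UNIV)"

definition plane_curve :: "(complex \<Rightarrow> real^2) \<Rightarrow> bool" where
  "plane_curve C \<longleftrightarrow>
     immersion C \<and> (\<forall>x. multiple_point C x \<longrightarrow> transversal_double_point C x)"

text \<open>A chord is the two-element set of its endpoints on the circle.\<close>

definition gauss_diagram :: "(complex \<Rightarrow> real^2) \<Rightarrow> complex set set" where
  "gauss_diagram C = {fibre C x | x. transversal_double_point C x}"

text \<open>Alternation along the circle: going once around, one meets in turn an endpoint of \<open>a\<close>, of
  \<open>b\<close>, of \<open>a\<close> and of \<open>b\<close>. The four endpoints are then distinct, so no chord crosses itself.\<close>

definition chords_cross :: "complex set \<Rightarrow> complex set \<Rightarrow> bool" where
  "chords_cross a b \<longleftrightarrow>
     (\<exists>t1 t2 t3 t4. t1 < t2 \<and> t2 < t3 \<and> t3 < t4 \<and> t4 < t1 + 2 * pi \<and>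
        a = {cis t1, cis t3} \<and> b = {cis t2, cis t4})"

definition crossing_chords :: "complex set set \<Rightarrow> complex set \<Rightarrow> complex set set" where
  "crossing_chords G c = {d \<in> G. chords_cross c d}"

end

theory Submission
  imports Defs
begin

text \<open>A chord joining \<open>cis s\<close> and \<open>cis t\<close> cuts the curve into two loops, and the chords crossing it are
  the other intersections of these two loops; the chords crossing two non-crossing chords are the
  intersections of two loops based at different double points. Intersections are the zeros of
  \<open>F (u, v) = g u - g v\<close> on a rectangle, \<open>g\<close> being the lifted curve in the complex plane. The
  winding of \<open>F\<close> along the boundary of a rectangle is additive under subdivision, and each
  transversal zero contributes \<open>\<plusminus>1\<close>; since the loops are closed, opposite sides of the
  whole rectangle cancel, so the number of zeros is even.\<close>

section \<open>Variation of the logarithm along a path and around a rectangle\<close>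

text \<open>Zeros can be counted from the boundary only if the boundary itself carries none, and
  this is where the two statements differ. For two non-crossing chords the loops have different base
  points, each with exactly two preimages, so arcs can be chosen on which neither loop meets the
  base point of the other, and the sides of the rectangle are free of zeros. For a single chord both
  loops begin and end at the same double point, so all four corners are zeros; transversality at
  that point is used a second time, to find a direction in which the loops can be pulled apart. Only
  parity is wanted, so the signs of intersections are discarded once each zero is known to cause one
  turn in some direction. The complex plane is convenient because transversality becomes the
  nonvanishing of \<open>Im (cnj \<alpha> * \<beta>)\<close> and a map can be divided by its linear
  part.\<close>

definition log_variation :: "(real \<Rightarrow> complex) \<Rightarrow> real \<Rightarrow> real \<Rightarrow> complex" where
  "log_variation p a b =
     (let g = SOME g. continuous_on {a..b} g \<and> (\<forall>t\<in>{a..b}. p t = exp (g t)) in g b - g a)"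

text \<open>Two continuous logarithms of one path differ by a continuous function with values in 2
  pi i Z. Distinct values are at least 2 pi apart, so this function is constant, and the increment
  does not depend on the logarithm picked by \<open>SOME\<close>. For a closed path it is 2 pi i
  times the winding number about 0.\<close>

lemma log_variation_eq:
  assumes "a \<le> b" and g: "continuous_on {a..b} g" "\<And>t. t \<in> {a..b} \<Longrightarrow> p t = exp (g t)"
  shows "log_variation p a b = g b - g a"
proof -
  define h where "h = (SOME h. continuous_on {a..b} h \<and> (\<forall>t\<in>{a..b}. p t = exp (h t)))"
  have h: "continuous_on {a..b} h \<and> (\<forall>t\<in>{a..b}. p t = exp (h t))"
    unfolding h_def by (rule someI[of _ g]) (use g in auto)
  have "(\<lambda>t. h t - g t) constant_on {a..b}"
  proof (rule continuous_discrete_range_constant)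
    show "continuous_on {a..b} (\<lambda>t. h t - g t)"
      using g h by (intro continuous_on_diff) auto
    fix x assume x: "x \<in> {a..b}"
    show "\<exists>e>0. \<forall>y. y \<in> {a..b} \<and> h y - g y \<noteq> h x - g x \<longrightarrow>
            e \<le> norm (h y - g y - (h x - g x))"
    proof (intro exI[of _ "2 * pi"] conjI allI impI)
      fix y assume y: "y \<in> {a..b} \<and> h y - g y \<noteq> h x - g x"
      have "exp (h y - g y) = exp (h x - g x)"
        using x y g(2) h by (metis exp_diff exp_not_eq_zero divide_self)
      then obtain n :: int where n: "h y - g y = h x - g x + (of_int (2 * n) * pi) * \<i>"
        using exp_eq by blast
      then have "n \<noteq> 0" using y by auto
      then have "\<bar>real_of_int n\<bar> \<ge> 1" by linarith
      moreover have "norm (h y - g y - (h x - g x)) = 2 * pi * \<bar>real_of_int n\<bar>"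
        using n by (simp add: norm_mult)
      ultimately show "2 * pi \<le> norm (h y - g y - (h x - g x))" by simp
    qed simp
  qed auto
  then have "h b - g b = h a - g a"
    using \<open>a \<le> b\<close> unfolding constant_on_def by fastforce
  then show ?thesis
    unfolding log_variation_def h_def[symmetric] Let_def by (simp add: algebra_simps)
qed

lemma continuous_log_exists:
  fixes p :: "'a::real_normed_vector \<Rightarrow> complex"
  assumes "convex S" "continuous_on S p" "\<And>t. t \<in> S \<Longrightarrow> p t \<noteq> 0"
  obtains g where "continuous_on S g" "\<And>t. t \<in> S \<Longrightarrow> p t = exp (g t)"
  using continuous_logarithm_on_contractible[of S p] convex_imp_contractible assms by blast

lemma log_variation_combine:
  assumes "a \<le> m" "m \<le> b" "continuous_on {a..b} p" "\<And>t. t \<in> {a..b} \<Longrightarrow> p t \<noteq> 0"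
  shows "log_variation p a b = log_variation p a m + log_variation p m b"
proof -
  obtain g where g: "continuous_on {a..b} g" "\<And>t. t \<in> {a..b} \<Longrightarrow> p t = exp (g t)"
    using continuous_log_exists[of "{a..b}" p] assms by auto
  have "log_variation p a b = g b - g a"
    using assms g by (intro log_variation_eq) auto
  moreover have "log_variation p a m = g m - g a"
    using assms g by (intro log_variation_eq continuous_on_subset[OF g(1)]) auto
  moreover have "log_variation p m b = g b - g m"
    using assms g by (intro log_variation_eq continuous_on_subset[OF g(1)]) auto
  ultimately show ?thesis by simp
qed

text \<open>The counterclockwise tour: every side is run in the increasing direction, so the top and
  left sides are subtracted.\<close>

definition boundary_variation ::
    "(real \<times> real \<Rightarrow> complex) \<Rightarrow> real \<Rightarrow> real \<Rightarrow> real \<Rightarrow> real \<Rightarrow> complex" where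
  "boundary_variation F a b c d =
     log_variation (\<lambda>u. F (u, c)) a b + log_variation (\<lambda>v. F (b, v)) c d
     - log_variation (\<lambda>u. F (u, d)) a b - log_variation (\<lambda>v. F (a, v)) c d"

text \<open>The rectangle is convex, so a nonvanishing \<open>F\<close> has one continuous logarithm
  on all of it; the increments along the sides are differences of its corner values and
  telescope.\<close>

lemma boundary_variation_zero_free:
  assumes "a \<le> b" "c \<le> d" and F: "continuous_on ({a..b} \<times> {c..d}) F"
    and nz: "\<And>z. z \<in> {a..b} \<times> {c..d} \<Longrightarrow> F z \<noteq> 0"
  shows "boundary_variation F a b c d = 0"
proof -
  obtain g where g: "continuous_on ({a..b} \<times> {c..d}) g"
      "\<And>z. z \<in> {a..b} \<times> {c..d} \<Longrightarrow> F z = exp (g z)"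
    using continuous_log_exists[of "{a..b} \<times> {c..d}" F] F nz by (auto intro: convex_Times)
  have "log_variation (\<lambda>u. F (u, y)) a b = g (b, y) - g (a, y)" if "y \<in> {c..d}" for y
    using assms g that
    by (intro log_variation_eq continuous_on_compose2[OF g(1)] continuous_intros) auto
  moreover have "log_variation (\<lambda>v. F (x, v)) c d = g (x, d) - g (x, c)" if "x \<in> {a..b}" for x
    using assms g that
    by (intro log_variation_eq continuous_on_compose2[OF g(1)] continuous_intros) auto
  ultimately show ?thesis
    using assms by (simp add: boundary_variation_def)
qed

text \<open>The cutting side at \<open>m\<close> occurs with both signs and cancels. Only the two
  sides that are themselves cut need additivity, hence these are the ones required to be zero
  free.\<close>

lemma boundary_variation_split_fst:
  assumes "a \<le> m" "m \<le> b" "c \<le> d" and F: "continuous_on ({a..b} \<times> {c..d}) F"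
    and "\<And>u. u \<in> {a..b} \<Longrightarrow> F (u, c) \<noteq> 0" "\<And>u. u \<in> {a..b} \<Longrightarrow> F (u, d) \<noteq> 0"
  shows "boundary_variation F a b c d = boundary_variation F a m c d + boundary_variation F m b c d"
proof -
  have "log_variation (\<lambda>u. F (u, y)) a b
      = log_variation (\<lambda>u. F (u, y)) a m + log_variation (\<lambda>u. F (u, y)) m b" if "y \<in> {c, d}" for y
    using assms that
    by (intro log_variation_combine continuous_on_compose2[OF F] continuous_intros) auto
  then show ?thesis by (simp add: boundary_variation_def)
qed

lemma boundary_variation_split_snd:
  assumes "c \<le> m" "m \<le> d" "a \<le> b" and F: "continuous_on ({a..b} \<times> {c..d}) F"
    and "\<And>v. v \<in> {c..d} \<Longrightarrow> F (a, v) \<noteq> 0" "\<And>v. v \<in> {c..d} \<Longrightarrow> F (b, v) \<noteq> 0"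
  shows "boundary_variation F a b c d = boundary_variation F a b c m + boundary_variation F a b m d"
proof -
  have "log_variation (\<lambda>v. F (x, v)) c d
      = log_variation (\<lambda>v. F (x, v)) c m + log_variation (\<lambda>v. F (x, v)) m d" if "x \<in> {a, b}" for x
    using assms that
    by (intro log_variation_combine continuous_on_compose2[OF F] continuous_intros) auto
  then show ?thesis by (simp add: boundary_variation_def)
qed

section \<open>Winding around a single transversal zero\<close>

lemma log_variation_mult:
  assumes "a \<le> b" "continuous_on {a..b} p" "\<And>t. t \<in> {a..b} \<Longrightarrow> p t \<noteq> 0"
    "continuous_on {a..b} q" "\<And>t. t \<in> {a..b} \<Longrightarrow> q t \<noteq> 0"
  shows "log_variation (\<lambda>t. p t * q t) a b = log_variation p a b + log_variation q a b"
proof -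
  obtain g where g: "continuous_on {a..b} g" "\<And>t. t \<in> {a..b} \<Longrightarrow> p t = exp (g t)"
    using continuous_log_exists[of "{a..b}" p] assms by auto
  obtain h where h: "continuous_on {a..b} h" "\<And>t. t \<in> {a..b} \<Longrightarrow> q t = exp (h t)"
    using continuous_log_exists[of "{a..b}" q] assms by auto
  have "log_variation (\<lambda>t. p t * q t) a b = (g b + h b) - (g a + h a)"
    using assms g h by (intro log_variation_eq continuous_on_add) (auto simp: exp_add)
  moreover have "log_variation p a b = g b - g a" "log_variation q a b = h b - h a"
    using assms g h by (auto intro!: log_variation_eq)
  ultimately show ?thesis by simp
qed

lemma log_variation_Ln:
  assumes "a \<le> b" "continuous_on {a..b} p" "\<And>t. t \<in> {a..b} \<Longrightarrow> p t \<notin> \<real>\<^sub>\<le>\<^sub>0"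
  shows "log_variation p a b = Ln (p b) - Ln (p a)"
proof -
  have "p t \<noteq> 0" if "t \<in> {a..b}" for t
    using assms(3)[OF that] by auto
  then show ?thesis
    using assms by (intro log_variation_eq[where g = "\<lambda>t. Ln (p t)"] continuous_intros) auto
qed

lemma log_variation_cong:
  assumes "\<And>t. t \<in> {a..b} \<Longrightarrow> p t = q t"
  shows "log_variation p a b = log_variation q a b"
proof -
  have "(\<lambda>g. continuous_on {a..b} g \<and> (\<forall>t\<in>{a..b}. p t = exp (g t)))
      = (\<lambda>g. continuous_on {a..b} g \<and> (\<forall>t\<in>{a..b}. q t = exp (g t)))"
    using assms by auto
  then show ?thesis unfolding log_variation_def by simp
qed

lemma log_variation_cmult:
  assumes "a \<le> b" "continuous_on {a..b} p" "\<And>t. t \<in> {a..b} \<Longrightarrow> p t \<noteq> 0" "k \<noteq> 0"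
  shows "log_variation (\<lambda>t. k * p t) a b = log_variation p a b"
proof -
  have "log_variation (\<lambda>t. k) a b = Ln k - Ln k"
    using assms by (intro log_variation_eq) auto
  then show ?thesis using assms by (subst log_variation_mult) auto
qed

lemma not_nonpos_Reals_if_Im: "Im z \<noteq> 0 \<Longrightarrow> z \<notin> \<real>\<^sub>\<le>\<^sub>0"
  by (auto simp: complex_nonpos_Reals_iff)

lemma Ln_minus_nonreal: "Im z \<noteq> 0 \<Longrightarrow> Ln (- z) = Ln z - \<i> * pi * sgn (Im z)"
  by (subst Ln_minus) (auto simp: sgn_if)

lemma boundary_variation_linear:
  assumes "Im \<tau> \<noteq> 0" "0 < e"
  shows "boundary_variation (\<lambda>(u, v). of_real (u - x) + of_real (v - y) * \<tau>)
           (x - e) (x + e) (y - e) (y + e) = 2 * pi * \<i> * sgn (Im \<tau>)"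
proof -
  let ?L = "\<lambda>(u, v). of_real (u - x) + of_real (v - y) * \<tau>"
  let ?E = "complex_of_real e"
  have horizontal: "log_variation (\<lambda>u. ?L (u, v)) (x - e) (x + e)
      = Ln (?L (x + e, v)) - Ln (?L (x - e, v))" if "v \<noteq> y" for v
    using assms that
    by (intro log_variation_Ln not_nonpos_Reals_if_Im continuous_intros) (auto intro!: continuous_intros)
  have right: "log_variation (\<lambda>v. ?L (x + e, v)) (y - e) (y + e)
      = Ln (?L (x + e, y + e)) - Ln (?L (x + e, y - e))"
    using assms by (intro log_variation_Ln) (auto intro!: continuous_intros simp: complex_nonpos_Reals_iff)
  \<comment> \<open>The left side crosses the negative real axis, the branch cut of
    \<open>Ln\<close>. Negating the path keeps its variation and moves the crossing to the positive
    axis; the jumps between \<open>Ln z\<close> and \<open>Ln (- z)\<close> at the two left corners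
    then add up to the full turn.\<close>
  have "log_variation (\<lambda>v. (-1) * ?L (x - e, v)) (y - e) (y + e)
      = Ln (- ?L (x - e, y + e)) - Ln (- ?L (x - e, y - e))"
    using assms by (subst log_variation_Ln) (auto intro!: continuous_intros simp: complex_nonpos_Reals_iff)
  moreover have "log_variation (\<lambda>v. (-1) * ?L (x - e, v)) (y - e) (y + e)
      = log_variation (\<lambda>v. ?L (x - e, v)) (y - e) (y + e)"
    using assms by (intro log_variation_cmult) (auto intro!: continuous_intros simp: complex_eq_iff)
  ultimately have left: "log_variation (\<lambda>v. ?L (x - e, v)) (y - e) (y + e)
      = Ln (?E - ?E * \<tau>) - Ln (?E + ?E * \<tau>)" by simp
  have "Ln (- (?E + ?E * \<tau>)) = Ln (?E + ?E * \<tau>) - \<i> * pi * sgn (Im \<tau>)"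
    "Ln (- (?E - ?E * \<tau>)) = Ln (?E - ?E * \<tau>) + \<i> * pi * sgn (Im \<tau>)"
    using assms Ln_minus_nonreal[of "?E + ?E * \<tau>"] Ln_minus_nonreal[of "?E - ?E * \<tau>"]
    by (simp_all add: sgn_mult)
  moreover have "- (?E + ?E * \<tau>) = - (?E * \<tau>) - ?E" "- (?E - ?E * \<tau>) = ?E * \<tau> - ?E"
    by simp_all
  ultimately have "Ln (- (?E * \<tau>) - ?E) = Ln (?E + ?E * \<tau>) - \<i> * pi * sgn (Im \<tau>)"
    "Ln (?E * \<tau> - ?E) = Ln (?E - ?E * \<tau>) + \<i> * pi * sgn (Im \<tau>)"
    by metis+
  then show ?thesis
    unfolding boundary_variation_def
    using assms by (simp only: horizontal[of "y - e"] horizontal[of "y + e"] right left) simp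
qed

lemma Im_divide_nonzero:
  assumes "Im (cnj \<alpha> * \<beta>) \<noteq> 0"
  shows "Im (\<beta> / \<alpha>) \<noteq> 0"
proof -
  have "\<alpha> \<noteq> 0" using assms by auto
  then have "\<beta> / \<alpha> = cnj \<alpha> * \<beta> / of_real ((cmod \<alpha>)\<^sup>2)"
    unfolding complex_norm_square by simp
  then have "Im (\<beta> / \<alpha>) = Im (cnj \<alpha> * \<beta>) / (cmod \<alpha>)\<^sup>2" by (simp only: Im_divide_of_real)
  then show ?thesis using assms \<open>\<alpha> \<noteq> 0\<close> by simp
qed

text \<open>Near the zero the quotient \<open>Q\<close> of \<open>F\<close> by its linear part stays
  within 1/2 of 1, where \<open>Ln\<close> is continuous. On each side the variations of
  \<open>F\<close> and of the linear map differ by an increment of \<open>Ln\<close> along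
  \<open>Q\<close>, and these increments cancel around the square.\<close>

lemma boundary_variation_nondegenerate_zero:
  assumes zero: "F (x, y) = 0" and nd: "Im (cnj \<alpha> * \<beta>) \<noteq> 0" and "0 < r"
    and der: "(F has_derivative (\<lambda>(h, k). of_real h * \<alpha> + of_real k * \<beta>)) (at (x, y))"
    and F: "continuous_on ({x - r..x + r} \<times> {y - r..y + r}) F"
  obtains e where "0 < e" "e < r"
    "boundary_variation F (x - e) (x + e) (y - e) (y + e) = 2 * pi * \<i> * sgn (Im (\<beta> / \<alpha>))"
proof -
  define D where "D = (\<lambda>(h, k). of_real h * \<alpha> + of_real k * \<beta> :: complex)"
  define \<tau> where "\<tau> = \<beta> / \<alpha>"
  define L where "L = (\<lambda>(u, v). of_real (u - x) + of_real (v - y) * \<tau>)"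
  define Q where "Q z = F z / (\<alpha> * L z)" for z
  have \<alpha>: "\<alpha> \<noteq> 0" using nd by auto
  have \<tau>: "Im \<tau> \<noteq> 0" using Im_divide_nonzero[OF nd] by (simp add: \<tau>_def)
  have L0: "L z \<noteq> 0" if "z \<noteq> (x, y)" for z
    using that \<tau> by (cases z) (auto simp: L_def complex_eq_iff)
  have DL: "D (z - (x, y)) = \<alpha> * L z" for z
    using \<alpha> by (cases z) (simp add: D_def L_def \<tau>_def algebra_simps)
  have "linear D" using der unfolding D_def by (rule has_derivative_linear)
  moreover have "inj D"
    unfolding linear_injective_0[OF \<open>linear D\<close>]
    using DL L0 \<alpha> by (metis add_diff_cancel_right' mult_eq_0_iff eq_iff_diff_eq_0)
  ultimately obtain B where B: "B > 0" "\<And>z. B * norm z \<le> norm (D z)"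
    using linear_inj_bounded_below_pos by blast
  \<comment> \<open>The tolerance \<open>B / 2\<close> turns the lower bound on \<open>D\<close>
    into an error of at most half the linear part.\<close>
  obtain \<delta> where \<delta>: "\<delta> > 0" "\<And>z. norm (z - (x, y)) < \<delta> \<Longrightarrow>
      norm (F z - F (x, y) - D (z - (x, y))) \<le> B / 2 * norm (z - (x, y))"
    using der \<open>B > 0\<close> unfolding has_derivative_at_alt D_def[symmetric]
    by (metis half_gt_zero)
  \<comment> \<open>\<open>r / 2\<close> gives \<open>e < r\<close>; \<open>\<delta> / 3\<close>
    gives \<open>2 * e < \<delta>\<close>, where \<open>2 * e\<close> bounds the distance to the
    centre via the sum of the two coordinate differences.\<close>
  define e where "e = min (r / 2) (\<delta> / 3)"
  \<comment> \<open>The centre is removed because \<open>Q\<close> is a division by zero there and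
    not close to 1.\<close>
  define S where "S = {x - e..x + e} \<times> {y - e..y + e} - {(x, y)}"
  have e: "0 < e" "e < r" "2 * e < \<delta>" using \<delta>(1) \<open>0 < r\<close> by (auto simp: e_def)
  have Q: "Re (Q z) > 0" if "z \<in> S" for z
  proof -
    obtain u v where z: "z = (u, v)" by fastforce
    have "norm (z - (x, y)) \<le> \<bar>u - x\<bar> + \<bar>v - y\<bar>"
      using norm_Pair_le[of "u - x" "v - y"] by (simp add: z)
    also have "\<dots> < \<delta>" using that e by (auto simp: S_def z)
    finally have "norm (F z - \<alpha> * L z) \<le> B / 2 * norm (z - (x, y))"
      using \<delta>(2)[of z] zero by (simp add: DL)
    also have "\<dots> \<le> norm (\<alpha> * L z) / 2" using B(2)[of "z - (x, y)"] by (simp add: DL)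
    finally have *: "norm (F z - \<alpha> * L z) \<le> norm (\<alpha> * L z) / 2" .
    have nz: "\<alpha> * L z \<noteq> 0" using L0[of z] \<alpha> that by (auto simp: S_def)
    have "norm (Q z - 1) = norm (F z - \<alpha> * L z) / norm (\<alpha> * L z)"
      unfolding norm_divide[symmetric] Q_def using nz by (simp add: diff_divide_distrib)
    also have "\<dots> \<le> 1 / 2" using * nz by (simp add: divide_le_eq)
    finally show ?thesis using abs_Re_le_cmod[of "Q z - 1"] by simp
  qed
  have contF: "continuous_on S F"
    using F by (rule continuous_on_subset) (use e in \<open>auto simp: S_def\<close>)
  have contL: "continuous_on S L"
    unfolding L_def case_prod_beta by (intro continuous_intros)
  have contQ: "continuous_on S Q"
    unfolding Q_def using contF contL L0 \<alpha> by (intro continuous_intros) (auto simp: S_def)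
  have side: "log_variation (\<lambda>t. F (\<gamma> t)) a b
      = log_variation (\<lambda>t. L (\<gamma> t)) a b + Ln (Q (\<gamma> b)) - Ln (Q (\<gamma> a))"
    if "a \<le> b" and \<gamma>: "continuous_on {a..b} \<gamma>" "\<gamma> ` {a..b} \<subseteq> S" for \<gamma> a b
  proof -
    have in_S: "\<gamma> t \<in> S" if "t \<in> {a..b}" for t using \<gamma>(2) that by blast
    have L\<gamma>: "continuous_on {a..b} (\<lambda>t. L (\<gamma> t))" "\<And>t. t \<in> {a..b} \<Longrightarrow> L (\<gamma> t) \<noteq> 0"
      using continuous_on_compose2[OF contL \<gamma>] L0 in_S by (auto simp: S_def)
    have Q\<gamma>: "continuous_on {a..b} (\<lambda>t. Q (\<gamma> t))"
      using continuous_on_compose2[OF contQ \<gamma>] .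
    have Re_Q: "Re (Q (\<gamma> t)) > 0" if "t \<in> {a..b}" for t
      using Q in_S that by blast
    have Q\<gamma>_nz: "Q (\<gamma> t) \<notin> \<real>\<^sub>\<le>\<^sub>0" "Q (\<gamma> t) \<noteq> 0" if "t \<in> {a..b}" for t
      using Re_Q[OF that] by (auto simp: complex_nonpos_Reals_iff)
    have "log_variation (\<lambda>t. F (\<gamma> t)) a b = log_variation (\<lambda>t. \<alpha> * (L (\<gamma> t) * Q (\<gamma> t))) a b"
      using L\<gamma> \<alpha> by (intro log_variation_cong) (simp add: Q_def)
    also have "\<dots> = log_variation (\<lambda>t. L (\<gamma> t)) a b + log_variation (\<lambda>t. Q (\<gamma> t)) a b"
      using \<open>a \<le> b\<close> L\<gamma> Q\<gamma> Q\<gamma>_nz \<alpha>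
      by (subst log_variation_cmult, auto intro: continuous_on_mult) (rule log_variation_mult, auto)
    also have "log_variation (\<lambda>t. Q (\<gamma> t)) a b = Ln (Q (\<gamma> b)) - Ln (Q (\<gamma> a))"
      using \<open>a \<le> b\<close> Q\<gamma> Q\<gamma>_nz by (intro log_variation_Ln) auto
    finally show ?thesis by simp
  qed
  have horizontal: "log_variation (\<lambda>u. F (u, v)) (x - e) (x + e)
      = log_variation (\<lambda>u. L (u, v)) (x - e) (x + e) + Ln (Q (x + e, v)) - Ln (Q (x - e, v))"
    if "v = y - e \<or> v = y + e" for v
    using e that by (intro side continuous_intros) (auto simp: S_def)
  have vertical: "log_variation (\<lambda>v. F (u, v)) (y - e) (y + e)
      = log_variation (\<lambda>v. L (u, v)) (y - e) (y + e) + Ln (Q (u, y + e)) - Ln (Q (u, y - e))"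
    if "u = x - e \<or> u = x + e" for u
    using e that by (intro side continuous_intros) (auto simp: S_def)
  have "boundary_variation F (x - e) (x + e) (y - e) (y + e)
      = boundary_variation L (x - e) (x + e) (y - e) (y + e)"
    by (simp add: boundary_variation_def horizontal vertical)
  also have "\<dots> = 2 * pi * \<i> * sgn (Im \<tau>)"
    unfolding L_def using \<tau> e by (intro boundary_variation_linear)
  finally show ?thesis using that e unfolding \<tau>_def by blast
qed

section \<open>Counting nondegenerate zeros modulo 2\<close>

text \<open>\<open>Im (cnj \<alpha> * \<beta>)\<close> is the determinant of the partial derivatives
  \<alpha> and \<beta>, so the condition is invertibility of the derivative.\<close>

definition nondegenerate_at :: "(real \<times> real \<Rightarrow> complex) \<Rightarrow> real \<times> real \<Rightarrow> bool" where
  "nondegenerate_at F z \<longleftrightarrow> (\<exists>\<alpha> \<beta>. Im (cnj \<alpha> * \<beta>) \<noteq> 0 \<and>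
     (F has_derivative (\<lambda>(h, k). of_real h * \<alpha> + of_real k * \<beta>)) (at z))"

definition zeros_in :: "(real \<times> real \<Rightarrow> complex) \<Rightarrow> real \<Rightarrow> real \<Rightarrow> real \<Rightarrow> real \<Rightarrow> (real \<times> real) set" where
  "zeros_in F a b c d = {z \<in> {a..b} \<times> {c..d}. F z = 0}"

text \<open>The argument principle reduced modulo 2: signs of zeros are forgotten, so rectangles are
  glued by adding integers and cardinalities alone.\<close>

definition variation_parity :: "(real \<times> real \<Rightarrow> complex) \<Rightarrow> real \<Rightarrow> real \<Rightarrow> real \<Rightarrow> real \<Rightarrow> bool" where
  "variation_parity F a b c d \<longleftrightarrow>
     (\<exists>k::int. boundary_variation F a b c d = 2 * pi * \<i> * k \<and> (even k \<longleftrightarrow> even (card (zeros_in F a b c d))))"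

lemma variation_parity_add:
  assumes "variation_parity F a b c d" "variation_parity F a' b' c' d'"
    and "finite (zeros_in F a'' b'' c'' d'')"
    and "zeros_in F a'' b'' c'' d'' = zeros_in F a b c d \<union> zeros_in F a' b' c' d'"
    and "zeros_in F a b c d \<inter> zeros_in F a' b' c' d' = {}"
    and "boundary_variation F a'' b'' c'' d''
         = boundary_variation F a b c d + boundary_variation F a' b' c' d'"
  shows "variation_parity F a'' b'' c'' d''"
proof -
  obtain k where k: "boundary_variation F a b c d = 2 * pi * \<i> * of_int k"
      "even k \<longleftrightarrow> even (card (zeros_in F a b c d))"
    using assms(1) unfolding variation_parity_def by blast
  obtain k' where k': "boundary_variation F a' b' c' d' = 2 * pi * \<i> * of_int k'"
      "even k' \<longleftrightarrow> even (card (zeros_in F a' b' c' d'))"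
    using assms(2) unfolding variation_parity_def by blast
  have "card (zeros_in F a'' b'' c'' d'') = card (zeros_in F a b c d) + card (zeros_in F a' b' c' d')"
    using assms(3-5) by (simp add: card_Un_disjoint)
  then show ?thesis
    unfolding variation_parity_def using assms(6) k k'
    by (intro exI[of _ "k + k'"]) (auto simp: ring_distribs)
qed

lemma variation_parity_zero_free:
  assumes "a \<le> b" "c \<le> d" "continuous_on ({a..b} \<times> {c..d}) F" "zeros_in F a b c d = {}"
  shows "variation_parity F a b c d"
proof -
  have "boundary_variation F a b c d = 0"
    using assms by (intro boundary_variation_zero_free) (auto simp: zeros_in_def)
  then show ?thesis
    unfolding variation_parity_def using assms(4) by (intro exI[of _ 0]) simp
qed

lemma variation_parity_split_fst:
  assumes "a \<le> m" "m \<le> b" "c \<le> d" "continuous_on ({a..b} \<times> {c..d}) F"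
    and "finite (zeros_in F a b c d)" "zeros_in F a b c d \<subseteq> ({a<..<b} - {m}) \<times> {c<..<d}"
    and "variation_parity F a m c d" "variation_parity F m b c d"
  shows "variation_parity F a b c d"
proof (rule variation_parity_add[OF assms(7,8,5)])
  show "zeros_in F a b c d = zeros_in F a m c d \<union> zeros_in F m b c d"
    using assms(1,2) by (force simp: zeros_in_def)
  show "zeros_in F a m c d \<inter> zeros_in F m b c d = {}"
    using assms(1,2,6) by (force simp: zeros_in_def)
  show "boundary_variation F a b c d = boundary_variation F a m c d + boundary_variation F m b c d"
    using assms by (intro boundary_variation_split_fst) (force simp: zeros_in_def)+
qed

lemma variation_parity_split_snd:
  assumes "c \<le> m" "m \<le> d" "a \<le> b" "continuous_on ({a..b} \<times> {c..d}) F"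
    and "finite (zeros_in F a b c d)" "zeros_in F a b c d \<subseteq> {a<..<b} \<times> ({c<..<d} - {m})"
    and "variation_parity F a b c m" "variation_parity F a b m d"
  shows "variation_parity F a b c d"
proof (rule variation_parity_add[OF assms(7,8,5)])
  show "zeros_in F a b c d = zeros_in F a b c m \<union> zeros_in F a b m d"
    using assms(1,2) by (force simp: zeros_in_def)
  show "zeros_in F a b c m \<inter> zeros_in F a b m d = {}"
    using assms(1,2,6) by (force simp: zeros_in_def)
  show "boundary_variation F a b c d = boundary_variation F a b c m + boundary_variation F a b m d"
    using assms by (intro boundary_variation_split_snd) (force simp: zeros_in_def)+
qed

text \<open>A small square around the zero carries one turn in one of the two directions, an odd
  number. The rest of the rectangle falls into four zero-free pieces: above and below the square,
  and at full height to its left and right.\<close>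

lemma variation_parity_one_zero:
  assumes F: "continuous_on ({a..b} \<times> {c..d}) F"
    and Z: "zeros_in F a b c d = {(x, y)}" and xy: "a < x" "x < b" "c < y" "y < d"
    and nd: "nondegenerate_at F (x, y)"
  shows "variation_parity F a b c d"
proof -
  obtain \<alpha> \<beta> where nd: "Im (cnj \<alpha> * \<beta>) \<noteq> 0"
      "(F has_derivative (\<lambda>(h, k). of_real h * \<alpha> + of_real k * \<beta>)) (at (x, y))"
    using nd unfolding nondegenerate_at_def by blast
  define r where "r = min (min (x - a) (b - x)) (min (y - c) (d - y))"
  have r: "0 < r" "a \<le> x - r" "x + r \<le> b" "c \<le> y - r" "y + r \<le> d"
    using xy by (auto simp: r_def)
  have zero: "F (x, y) = 0" using Z by (auto simp: zeros_in_def)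
  have cont: "continuous_on ({a'..b'} \<times> {c'..d'}) F"
    if "a \<le> a'" "b' \<le> b" "c \<le> c'" "d' \<le> d" for a' b' c' d'
    by (rule continuous_on_subset[OF F]) (use that in auto)
  have zeros: "zeros_in F a' b' c' d' = {(x, y)} \<inter> {a'..b'} \<times> {c'..d'}"
    if "a \<le> a'" "b' \<le> b" "c \<le> c'" "d' \<le> d" for a' b' c' d'
  proof -
    have "zeros_in F a' b' c' d' = zeros_in F a b c d \<inter> {a'..b'} \<times> {c'..d'}"
      using that by (auto simp: zeros_in_def)
    then show ?thesis using Z by simp
  qed
  obtain e where e: "0 < e" "e < r"
    and var: "boundary_variation F (x - e) (x + e) (y - e) (y + e) = 2 * pi * \<i> * sgn (Im (\<beta> / \<alpha>))"
    using boundary_variation_nondegenerate_zero[OF zero nd(1) r(1) nd(2) cont] r by blast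
  have "Im (\<beta> / \<alpha>) \<noteq> 0"
    using nd(1) by (rule Im_divide_nonzero)
  then obtain k :: int where "sgn (Im (\<beta> / \<alpha>)) = k" "odd k"
    by (metis even_minus odd_one of_int_1 of_int_minus sgn_if)
  with var have "variation_parity F (x - e) (x + e) (y - e) (y + e)"
    unfolding variation_parity_def using e r
    by (intro exI[of _ k]) (simp add: zeros)
  moreover have "variation_parity F (x - e) (x + e) c (y - e)" "variation_parity F (x - e) (x + e) (y + e) d"
    "variation_parity F a (x - e) c d" "variation_parity F (x + e) b c d"
    using e r by (auto intro!: variation_parity_zero_free cont simp: zeros)
  ultimately have parts: "variation_parity F (x - e) (x + e) (y - e) (y + e)"
    "variation_parity F (x - e) (x + e) c (y - e)" "variation_parity F (x - e) (x + e) (y + e) d"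
    "variation_parity F a (x - e) c d" "variation_parity F (x + e) b c d"
    by blast+
  have "variation_parity F (x - e) (x + e) c (y + e)"
    by (rule variation_parity_split_snd[OF _ _ _ _ _ _ parts(2,1)])
      (use e r xy in \<open>auto intro!: cont simp: zeros\<close>)
  then have "variation_parity F (x - e) (x + e) c d"
    by (rule variation_parity_split_snd[OF _ _ _ _ _ _ _ parts(3), rotated 6])
      (use e r xy in \<open>auto intro!: cont simp: zeros\<close>)
  then have "variation_parity F (x - e) b c d"
    by (rule variation_parity_split_fst[OF _ _ _ _ _ _ _ parts(5), rotated 6])
      (use e r xy in \<open>auto intro!: cont simp: zeros\<close>)
  then show ?thesis
    by (rule variation_parity_split_fst[OF _ _ _ _ _ _ parts(4), rotated 6])
      (use e r xy in \<open>auto intro!: cont simp: zeros\<close>)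
qed

lemma exists_between_avoiding:
  fixes x y :: real
  assumes "x < y" "finite S"
  obtains m where "x < m" "m < y" "m \<notin> S"
proof -
  have "infinite ({x<..<y} - S)" using assms by (intro Diff_infinite_finite) auto
  then obtain m where "m \<in> {x<..<y} - S" by (metis ex_in_conv finite.emptyI)
  then show ?thesis using that by auto
qed

text \<open>Two distinct zeros differ in some coordinate. A line between them in that coordinate
  that misses every zero leaves fewer zeros on either side, so induction on their number reduces to
  rectangles with at most one.\<close>

lemma variation_parity_nondegenerate:
  assumes "a \<le> b" "c \<le> d" "continuous_on ({a..b} \<times> {c..d}) F"
    and "finite (zeros_in F a b c d)" "zeros_in F a b c d \<subseteq> {a<..<b} \<times> {c<..<d}"
    and "\<And>z. z \<in> zeros_in F a b c d \<Longrightarrow> nondegenerate_at F z"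
  shows "variation_parity F a b c d"
  using assms
proof (induction "card (zeros_in F a b c d)" arbitrary: a b c d rule: less_induct)
  case less
  \<comment> \<open>The zero \<open>z\<close> left outside the smaller rectangle makes the count
    drop strictly.\<close>
  have sub: "variation_parity F a' b' c' d'"
    if "a \<le> a'" "a' \<le> b'" "b' \<le> b" "c \<le> c'" "c' \<le> d'" "d' \<le> d"
      and interior: "zeros_in F a' b' c' d' \<subseteq> {a'<..<b'} \<times> {c'<..<d'}"
      and z: "z \<in> zeros_in F a b c d" "z \<notin> {a'..b'} \<times> {c'..d'}" for a' b' c' d' z
  proof -
    have subset: "zeros_in F a' b' c' d' \<subset> zeros_in F a b c d"
      using that unfolding zeros_in_def by fastforce
    then have "card (zeros_in F a' b' c' d') < card (zeros_in F a b c d)"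
      using less.prems by (intro psubset_card_mono)
    moreover have "finite (zeros_in F a' b' c' d')"
      using subset less.prems by (meson finite_subset psubset_imp_subset)
    moreover have "continuous_on ({a'..b'} \<times> {c'..d'}) F"
      using that by (intro continuous_on_subset[OF less.prems(3)]) auto
    ultimately show ?thesis
      using less.hyps[of a' b' c' d'] less.prems(6) subset that by blast
  qed
  have interior: "z \<in> zeros_in F a b c d \<Longrightarrow> a < fst z \<and> fst z < b \<and> c < snd z \<and> snd z < d" for z
    using less.prems(5) by fastforce
  have fin: "finite (fst ` zeros_in F a b c d)" "finite (snd ` zeros_in F a b c d)"
    using less.prems by auto
  consider "zeros_in F a b c d = {}" | z where "zeros_in F a b c d = {z}"
    | z w where "z \<in> zeros_in F a b c d" "w \<in> zeros_in F a b c d" "z \<noteq> w"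
    by blast
  then show ?case
  proof cases
    case 1
    then show ?thesis using less.prems by (intro variation_parity_zero_free)
  next
    case 2
    have "a < fst z \<and> fst z < b \<and> c < snd z \<and> snd z < d" using interior[of z] 2 by simp
    then show ?thesis
      using 2 less.prems by (intro variation_parity_one_zero[of _ _ _ _ _ "fst z" "snd z"]) auto
  next
    case 3
    then consider "fst z \<noteq> fst w" | "snd z \<noteq> snd w" by (metis prod.expand)
    then show ?thesis
    proof cases
      case 1
      then obtain p q where pq: "p \<in> zeros_in F a b c d" "q \<in> zeros_in F a b c d" "fst p < fst q"
        using 3(1,2) by (cases "fst z" "fst w" rule: linorder_cases) auto
      obtain m where m: "fst p < m" "m < fst q" "m \<notin> fst ` zeros_in F a b c d"
        using exists_between_avoiding[OF pq(3) fin(1)] .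
      have am: "a \<le> m" "m \<le> b" using m interior[OF pq(1)] interior[OF pq(2)] by auto
      have off: "zeros_in F a b c d \<subseteq> ({a<..<b} - {m}) \<times> {c<..<d}"
        using m(3) less.prems(5) by (force simp: image_iff)
      have "variation_parity F a m c d"
      proof (rule sub[OF _ _ _ _ _ _ _ pq(2)])
        have "zeros_in F a m c d \<subseteq> zeros_in F a b c d" "zeros_in F a m c d \<subseteq> {a..m} \<times> {c..d}"
          using am by (auto simp: zeros_in_def)
        then show "zeros_in F a m c d \<subseteq> {a<..<m} \<times> {c<..<d}" using off by fastforce
        show "q \<notin> {a..m} \<times> {c..d}" using m(1,2) by (simp add: mem_Times_iff)
      qed (use am less.prems in simp_all)
      moreover have "variation_parity F m b c d"
      proof (rule sub[OF _ _ _ _ _ _ _ pq(1)])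
        have "zeros_in F m b c d \<subseteq> zeros_in F a b c d" "zeros_in F m b c d \<subseteq> {m..b} \<times> {c..d}"
          using am by (auto simp: zeros_in_def)
        then show "zeros_in F m b c d \<subseteq> {m<..<b} \<times> {c<..<d}" using off by fastforce
        show "p \<notin> {m..b} \<times> {c..d}" using m(1,2) by (simp add: mem_Times_iff)
      qed (use am less.prems in simp_all)
      ultimately show ?thesis
        using variation_parity_split_fst am less.prems off by blast
    next
      case 2
      then obtain p q where pq: "p \<in> zeros_in F a b c d" "q \<in> zeros_in F a b c d" "snd p < snd q"
        using 3(1,2) by (cases "snd z" "snd w" rule: linorder_cases) auto
      obtain m where m: "snd p < m" "m < snd q" "m \<notin> snd ` zeros_in F a b c d"
        using exists_between_avoiding[OF pq(3) fin(2)] .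
      have am: "c \<le> m" "m \<le> d" using m interior[OF pq(1)] interior[OF pq(2)] by auto
      have off: "zeros_in F a b c d \<subseteq> {a<..<b} \<times> ({c<..<d} - {m})"
        using m(3) less.prems(5) by (force simp: image_iff)
      have "variation_parity F a b c m"
      proof (rule sub[OF _ _ _ _ _ _ _ pq(2)])
        have "zeros_in F a b c m \<subseteq> zeros_in F a b c d" "zeros_in F a b c m \<subseteq> {a..b} \<times> {c..m}"
          using am by (auto simp: zeros_in_def)
        then show "zeros_in F a b c m \<subseteq> {a<..<b} \<times> {c<..<m}" using off by fastforce
        show "q \<notin> {a..b} \<times> {c..m}" using m(1,2) by (simp add: mem_Times_iff)
      qed (use am less.prems in simp_all)
      moreover have "variation_parity F a b m d"
      proof (rule sub[OF _ _ _ _ _ _ _ pq(1)])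
        have "zeros_in F a b m d \<subseteq> zeros_in F a b c d" "zeros_in F a b m d \<subseteq> {a..b} \<times> {m..d}"
          using am by (auto simp: zeros_in_def)
        then show "zeros_in F a b m d \<subseteq> {a<..<b} \<times> {m<..<d}" using off by fastforce
        show "p \<notin> {a..b} \<times> {m..d}" using m(1,2) by (simp add: mem_Times_iff)
      qed (use am less.prems in simp_all)
      ultimately show ?thesis
        using variation_parity_split_snd am less.prems off by blast
    qed
  qed
qed

text \<open>An infinite set of zeros would have cardinality \<open>0\<close>, which is even.\<close>

lemma even_card_zeros_doubly_periodic:
  assumes "a \<le> b" "c \<le> d" "continuous_on ({a..b} \<times> {c..d}) F"
    and "\<And>v. v \<in> {c..d} \<Longrightarrow> F (a, v) = F (b, v)" "\<And>u. u \<in> {a..b} \<Longrightarrow> F (u, c) = F (u, d)"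
    and "zeros_in F a b c d \<subseteq> {a<..<b} \<times> {c<..<d}"
    and "\<And>z. z \<in> zeros_in F a b c d \<Longrightarrow> nondegenerate_at F z"
  shows "even (card (zeros_in F a b c d))"
proof (cases "finite (zeros_in F a b c d)")
  case True
  have "boundary_variation F a b c d = 0"
    unfolding boundary_variation_def
    using log_variation_cong[of a b "\<lambda>u. F (u, c)" "\<lambda>u. F (u, d)"]
      log_variation_cong[of c d "\<lambda>v. F (a, v)" "\<lambda>v. F (b, v)"] assms(4,5) by simp
  moreover have "variation_parity F a b c d"
    using assms True by (intro variation_parity_nondegenerate)
  ultimately show ?thesis unfolding variation_parity_def by auto
qed auto

section \<open>Intersections of two closed loops\<close>

text \<open>The two loops share their base point, so \<open>F = g u - g v\<close> vanishes at the corners of the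
  rectangle. Both loops leave the base point into opposite half planes, separated by the functional
  \<open>l\<close>, so adding a bump in the direction \<open>w\<close> removes the zeros at the corners and creates no
  new ones. The bump depends only on the distances to the end points, hence opposite sides still
  agree.\<close>

lemma even_card_coincidences_touching_loops:
  fixes g :: "real \<Rightarrow> complex" and l :: "complex \<Rightarrow> real"
  assumes "s < t" "t < r" and g: "continuous_on UNIV g" and base: "g t = g s" "g r = g s"
    and simple: "\<And>u. u \<in> {s<..<t} \<union> {t<..<r} \<Longrightarrow> g u \<noteq> g s"
    and l: "linear l" "l w > 0" and "e > 0"
    and near: "\<And>h. 0 < h \<Longrightarrow> h \<le> e \<Longrightarrow> l (g (s + h)) > l (g s) \<and> l (g (t - h)) > l (g s)
                  \<and> l (g (t + h)) < l (g s) \<and> l (g (r - h)) < l (g s)"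
    and nd: "\<And>z. z \<in> {s<..<t} \<times> {t<..<r} \<Longrightarrow> g (fst z) = g (snd z) \<Longrightarrow>
                  nondegenerate_at (\<lambda>z. g (fst z) - g (snd z)) z"
  shows "even (card {z \<in> {s<..<t} \<times> {t<..<r}. g (fst z) = g (snd z)})"
proof -
  \<comment> \<open>On the rectangle \<open>m\<close> vanishes exactly at the four corners, and it
    agrees at opposite boundary points.\<close>
  define m where "m z = min (fst z - s) (t - fst z) + min (snd z - t) (r - snd z)" for z
  define F where "F z = g (fst z) - g (snd z)" for z
  define F' where "F' z = F z + of_real (max 0 (e - m z)) * w" for z
  have left: "l (g u) > l (g s) \<or> u = s \<or> u = t"
    if "u \<in> {s..t}" "min (u - s) (t - u) \<le> e" for u
    using near[of "u - s"] near[of "t - u"] that by (cases "s < u"; cases "u < t") (auto simp: min_le_iff_disj)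
  have right: "l (g v) < l (g s) \<or> v = t \<or> v = r"
    if "v \<in> {t..r}" "min (v - t) (r - v) \<le> e" for v
    using near[of "v - t"] near[of "r - v"] that by (cases "t < v"; cases "v < r") (auto simp: min_le_iff_disj)
  \<comment> \<open>Both summands of \<open>m z\<close> are nonnegative, so
    \<open>m z \<le> e\<close> puts each coordinate within \<open>e\<close> of an end of its
    interval, where \<open>near\<close> tells on which side of the separating line the loop
    runs.\<close>
  have corner: "l (F z) > 0 \<or> (fst z \<in> {s, t} \<and> snd z \<in> {t, r} \<and> l (F z) = 0)"
    if "z \<in> {s..t} \<times> {t..r}" "m z \<le> e" for z
  proof -
    have "0 \<le> min (fst z - s) (t - fst z)" "0 \<le> min (snd z - t) (r - snd z)"
      using that(1) by auto
    then have "min (fst z - s) (t - fst z) \<le> e" "min (snd z - t) (r - snd z) \<le> e"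
      using that(2) unfolding m_def by linarith+
    then have "l (g (fst z)) > l (g s) \<or> fst z = s \<or> fst z = t"
      "l (g (snd z)) < l (g s) \<or> snd z = t \<or> snd z = r"
      using left[of "fst z"] right[of "snd z"] that(1) by auto
    then show ?thesis
      using base by (auto simp: F_def linear_diff[OF l(1)])
  qed
  \<comment> \<open>In the perturbed region \<open>l\<close> is positive on \<open>F'\<close>: away
    from the corners already because of \<open>F\<close>, and at the corners, where
    \<open>m z = 0\<close>, because of the full bump \<open>e * w\<close>.\<close>
  have F'_near: "F' z \<noteq> 0" if "z \<in> {s..t} \<times> {t..r}" "m z \<le> e" for z
  proof -
    have "l (F' z) = l (F z) + (e - m z) * l w"
      using that linear_cmul[OF l(1), of "e - m z" w]
      by (simp add: F'_def linear_add[OF l(1)] scaleR_conv_of_real)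
    moreover have "(e - m z) * l w \<ge> 0" using that l by simp
    moreover have "(e - m z) * l w > 0" if "fst z \<in> {s, t}" "snd z \<in> {t, r}"
    proof -
      have "m z = 0" using that assms(1,2) by (auto simp: m_def min_def)
      then show ?thesis using l \<open>e > 0\<close> by simp
    qed
    ultimately have "l (F' z) > 0" using corner[OF that] by linarith
    then show ?thesis using linear_0[OF l(1)] by auto
  qed
  have F'_far: "F' z = F z" if "m z > e" for z using that by (simp add: F'_def)
  have inside: "z \<in> {s<..<t} \<times> {t<..<r}" if "z \<in> {s..t} \<times> {t..r}" "F' z = 0" for z
  proof (rule ccontr)
    obtain u v where z: "z = (u, v)" by fastforce
    have far: "m z > e" using F'_near[OF that(1)] that(2) by force
    then have "g u = g v" using that(2) by (simp add: F'_far F_def z)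
    moreover assume "z \<notin> {s<..<t} \<times> {t<..<r}"
    then have "u = s \<or> u = t \<or> v = t \<or> v = r" using that(1) by (auto simp: z)
    ultimately have "g u = g s" "g v = g s" using base by metis+
    then have "u \<notin> {s<..<t}" "v \<notin> {t<..<r}" using simple by blast+
    then have "u \<in> {s, t}" "v \<in> {t, r}" using that(1) by (auto simp: z)
    then have "m z = 0" using assms(1,2) by (auto simp: m_def min_def z)
    then show False using far \<open>e > 0\<close> by simp
  qed
  have zeros: "zeros_in F' s t t r = {z \<in> {s<..<t} \<times> {t<..<r}. g (fst z) = g (snd z)}"
  proof (intro subset_antisym subsetI)
    fix z assume "z \<in> zeros_in F' s t t r"
    then have z: "z \<in> {s..t} \<times> {t..r}" "F' z = 0" by (auto simp: zeros_in_def)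
    then have "m z > e" using F'_near by force
    then show "z \<in> {z \<in> {s<..<t} \<times> {t<..<r}. g (fst z) = g (snd z)}"
      using inside[OF z] z(2) by (simp add: F'_far F_def)
  next
    fix z assume z: "z \<in> {z \<in> {s<..<t} \<times> {t<..<r}. g (fst z) = g (snd z)}"
    then have z': "z \<in> {s..t} \<times> {t..r}" and Fz: "F z = 0" by (auto simp: F_def)
    \<comment> \<open>A genuine coincidence has \<open>l (F z) = 0\<close> and is no corner, so it
      cannot lie in the perturbed region.\<close>
    have "m z > e"
    proof (rule ccontr)
      assume "\<not> m z > e"
      then show False using corner[OF z'] z Fz linear_0[OF l(1)] by auto
    qed
    then show "z \<in> zeros_in F' s t t r"
      using z' Fz by (simp add: F'_far zeros_in_def)
  qed
  have contm: "continuous_on UNIV m" unfolding m_def by (intro continuous_intros)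
  have contF: "continuous_on UNIV F"
    unfolding F_def by (intro continuous_intros continuous_on_compose2[OF g]) auto
  have nd': "nondegenerate_at F' z" if z: "z \<in> zeros_in F' s t t r" for z
  proof -
    have far: "m z > e" using F'_near z by (force simp: zeros_in_def)
    have "nondegenerate_at F z"
      using nd[of z] z unfolding zeros F_def by simp
    \<comment> \<open>\<open>F'\<close> equals \<open>F\<close> on this open set, so the derivative
      carries over.\<close>
    moreover have "open {z. e < m z}"
      using contm by (intro open_Collect_less) auto
    ultimately show ?thesis
      unfolding nondegenerate_at_def
      using has_derivative_transform_within_open[of F _ z UNIV "{z. e < m z}" F'] far F'_far by auto
  qed
  have "even (card (zeros_in F' s t t r))"
  proof (rule even_card_zeros_doubly_periodic)
    show "continuous_on ({s..t} \<times> {t..r}) F'"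
      unfolding F'_def using contm contF
      by (intro continuous_intros) (auto intro: continuous_on_subset)
    show "F' (s, v) = F' (t, v)" if "v \<in> {t..r}" for v
      using base assms(1) by (simp add: F'_def F_def m_def min_def)
    show "F' (u, t) = F' (u, r)" if "u \<in> {s..t}" for u
      using base assms(2) by (simp add: F'_def F_def m_def min_def)
    show "zeros_in F' s t t r \<subseteq> {s<..<t} \<times> {t<..<r}" using zeros by blast
  qed (use assms nd' in auto)
  then show ?thesis by (simp add: zeros)
qed

text \<open>A zero on a side of the rectangle would place a point of one loop at the base point of
  the other; the two avoidance hypotheses exclude this, so the difference is counted without
  perturbation.\<close>

lemma even_card_coincidences_disjoint_base:
  fixes g :: "real \<Rightarrow> complex"
  assumes "s < t" "p < q" and g: "continuous_on UNIV g" and base: "g t = g s" "g q = g p"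
    and "\<And>u. u \<in> {s..t} \<Longrightarrow> g u \<noteq> g p" "\<And>v. v \<in> {p..q} \<Longrightarrow> g v \<noteq> g s"
    and nd: "\<And>z. z \<in> {s<..<t} \<times> {p<..<q} \<Longrightarrow> g (fst z) = g (snd z) \<Longrightarrow>
                  nondegenerate_at (\<lambda>z. g (fst z) - g (snd z)) z"
  shows "even (card {z \<in> {s<..<t} \<times> {p<..<q}. g (fst z) = g (snd z)})"
proof -
  let ?F = "\<lambda>z. g (fst z) - g (snd z)"
  have zeros: "zeros_in ?F s t p q = {z \<in> {s<..<t} \<times> {p<..<q}. g (fst z) = g (snd z)}"
  proof -
    have "u \<in> {s<..<t} \<and> v \<in> {p<..<q}" if "u \<in> {s..t}" "v \<in> {p..q}" "g u = g v" for u v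
    proof -
      have "u \<noteq> s" "u \<noteq> t" "v \<noteq> p" "v \<noteq> q"
        using assms(6)[of u] assms(7)[of v] base that by metis+
      then show ?thesis using that by auto
    qed
    then show ?thesis unfolding zeros_in_def by auto
  qed
  have "even (card (zeros_in ?F s t p q))"
  proof (rule even_card_zeros_doubly_periodic)
    show "continuous_on ({s..t} \<times> {p..q}) ?F"
      by (intro continuous_intros continuous_on_compose2[OF g]) auto
  qed (use assms zeros in auto)
  then show ?thesis by (simp add: zeros)
qed

section \<open>Chords of a plane curve\<close>

lemma cis_add_2pi_int: "cis (x + 2 * pi * of_int n) = cis x"
  by (simp add: cis_mult[symmetric] cis_multiple_2pi)

lemma cis_eq_iff: "cis x = cis y \<longleftrightarrow> (\<exists>n::int. x = y + 2 * pi * of_int n)"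
  using sin_cos_eq_iff[of x y] by (simp add: complex_eq_iff conj_commute)

lemma cis_inj_within_period:
  assumes "cis x = cis y" "\<bar>x - y\<bar> < 2 * pi"
  shows "x = y"
proof -
  obtain n :: int where n: "x = y + 2 * pi * of_int n" using assms(1) cis_eq_iff by blast
  then have "2 * pi * \<bar>real_of_int n\<bar> < 2 * pi * 1" using assms(2) by (simp add: abs_mult)
  then have "\<bar>real_of_int n\<bar> < 1" by (subst (asm) mult_less_cancel_left_pos) auto
  then have "n = 0" by linarith
  then show ?thesis using n by simp
qed

lemma unit_eq_cis_in_period:
  assumes "norm z = 1"
  shows "\<exists>x\<in>{s..<s + 2 * pi}. z = cis x"
proof -
  define n where "n = \<lfloor>(Arg z - s) / (2 * pi)\<rfloor>"
  have "real_of_int n \<le> (Arg z - s) / (2 * pi)" "(Arg z - s) / (2 * pi) < real_of_int n + 1"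
    unfolding n_def by linarith+
  then have "Arg z + 2 * pi * of_int (- n) \<in> {s..<s + 2 * pi}"
    by (simp add: field_simps)
  moreover have "z = cis (Arg z)"
    using assms rcis_cmod_Arg[of z] by (simp add: rcis_def)
  ultimately show ?thesis using cis_add_2pi_int[of "Arg z" "- n"] by metis
qed

text \<open>The alternating parameters may start at either end of the chord and on any turn. A
  common shift by a multiple of 2 pi moves the first of them to \<open>s\<close> or to
  \<open>t\<close>, and injectivity of \<open>cis\<close> within a period then locates the
  third.\<close>

lemma chords_cross_cis_iff:
  assumes "s < t" "t < s + 2 * pi"
  shows "chords_cross {cis s, cis t} d \<longleftrightarrow>
    (\<exists>u v. s < u \<and> u < t \<and> t < v \<and> v < s + 2 * pi \<and> d = {cis u, cis v})"
proof
  assume "chords_cross {cis s, cis t} d"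
  then obtain t1 t2 t3 t4 where t: "t1 < t2" "t2 < t3" "t3 < t4" "t4 < t1 + 2 * pi"
      "{cis s, cis t} = {cis t1, cis t3}" and d: "d = {cis t2, cis t4}"
    unfolding chords_cross_def by blast
  consider "cis t1 = cis s" "cis t3 = cis t" | "cis t1 = cis t" "cis t3 = cis s"
    using t(5) by (metis doubleton_eq_iff)
  then show "\<exists>u v. s < u \<and> u < t \<and> t < v \<and> v < s + 2 * pi \<and> d = {cis u, cis v}"
  proof cases
    case 1
    then obtain n :: int where n: "t1 = s + 2 * pi * of_int n" using cis_eq_iff by blast
    define sh where "sh x = x + 2 * pi * of_int (- n)" for x
    have cis_sh: "cis (sh x) = cis x" for x unfolding sh_def by (rule cis_add_2pi_int)
    have "sh t1 = s" by (simp add: sh_def n)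
    then have sh: "s < sh t2" "sh t2 < sh t3" "sh t3 < sh t4" "sh t4 < s + 2 * pi"
      using t by (auto simp: sh_def)
    have "sh t3 = t"
      by (rule cis_inj_within_period) (use 1 cis_sh sh assms in auto)
    then show ?thesis using sh cis_sh d by metis
  next
    case 2
    then obtain n :: int where n: "t1 = t + 2 * pi * of_int n" using cis_eq_iff by blast
    define sh where "sh x = x + 2 * pi * of_int (- n)" for x
    have cis_sh: "cis (sh x) = cis x" for x unfolding sh_def by (rule cis_add_2pi_int)
    have "sh t1 = t" by (simp add: sh_def n)
    then have sh: "t < sh t2" "sh t2 < sh t3" "sh t3 < sh t4" "sh t4 < t + 2 * pi"
      using t by (auto simp: sh_def)
    \<comment> \<open>Starting from \<open>t\<close>, the point \<open>cis s\<close> is next met at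
      \<open>s + 2 * pi\<close>. Hence \<open>sh t4\<close> lies beyond it and has to go back one
      turn to fall between \<open>s\<close> and \<open>t\<close>.\<close>
    have "sh t3 = s + 2 * pi"
      by (rule cis_inj_within_period) (use 2 cis_sh sh assms cis_add_2pi_int[of s 1] in auto)
    moreover have "cis (sh t4 - 2 * pi) = cis t4"
      using cis_add_2pi_int[of "sh t4" "-1"] cis_sh by simp
    ultimately show ?thesis
      using sh cis_sh[of t2] d
      by (intro exI[of _ "sh t4 - 2 * pi"] exI[of _ "sh t2"]) (auto simp: insert_commute)
  qed
next
  assume "\<exists>u v. s < u \<and> u < t \<and> t < v \<and> v < s + 2 * pi \<and> d = {cis u, cis v}"
  then show "chords_cross {cis s, cis t} d" unfolding chords_cross_def by blast
qed

section \<open>Plane vectors as complex numbers, and transversality as a determinant\<close>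

definition complex_of_plane :: "real^2 \<Rightarrow> complex" where
  "complex_of_plane x = Complex (x $ 1) (x $ 2)"

lemma linear_complex_of_plane: "linear complex_of_plane"
  by (rule linearI) (simp_all add: complex_of_plane_def complex_eq_iff)

lemma complex_of_plane_eq_iff [simp]: "complex_of_plane x = complex_of_plane y \<longleftrightarrow> x = y"
  by (simp add: complex_of_plane_def vec_eq_iff forall_2)

text \<open>Expressing both unit vectors through \<open>x\<close> and \<open>y\<close> yields a
  right inverse of the matrix with these columns, so its determinant, which is this imaginary part,
  cannot vanish.\<close>

lemma Im_cnj_mult_nonzero_if_span:
  assumes "span {x, y} = (UNIV :: (real^2) set)"
  shows "Im (cnj (complex_of_plane x) * complex_of_plane y) \<noteq> 0"
proof
  assume "Im (cnj (complex_of_plane x) * complex_of_plane y) = 0"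
  then have det: "x $ 1 * y $ 2 = x $ 2 * y $ 1" by (simp add: complex_of_plane_def)
  have in_span: "\<exists>a b. z = a *\<^sub>R x + b *\<^sub>R y" for z :: "real^2"
  proof -
    have "z \<in> span {x, y}" using assms by simp
    then obtain a b where "z - a *\<^sub>R x = b *\<^sub>R y"
      by (auto simp: span_breakdown_eq span_singleton)
    then show ?thesis by (metis add.commute diff_add_cancel)
  qed
  obtain a b where "axis 1 1 = a *\<^sub>R x + b *\<^sub>R y" using in_span by blast
  then have ab: "a * x $ 1 + b * y $ 1 = 1" "a * x $ 2 + b * y $ 2 = 0"
    by (simp_all add: vec_eq_iff forall_2 axis_def)
  obtain c d where "axis 2 1 = c *\<^sub>R x + d *\<^sub>R y" using in_span by blast
  then have cd: "c * x $ 1 + d * y $ 1 = 0" "c * x $ 2 + d * y $ 2 = 1"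
    by (simp_all add: vec_eq_iff forall_2 axis_def)
  show False using ab cd det by algebra
qed

definition planar_lift :: "(complex \<Rightarrow> real^2) \<Rightarrow> real \<Rightarrow> complex" where
  "planar_lift C t = complex_of_plane (lift C t)"

lemma planar_lift_eq_iff: "planar_lift C u = planar_lift C v \<longleftrightarrow> C (cis u) = C (cis v)"
  by (simp add: planar_lift_def lift_def)

lemma planar_lift_has_vector_derivative:
  assumes "plane_curve C"
  shows "(planar_lift C has_vector_derivative complex_of_plane (velocity C t)) (at t)"
proof -
  have "lift C differentiable at t"
    using assms unfolding plane_curve_def immersion_def by (simp add: C1_differentiable_on_eq)
  then have "(lift C has_vector_derivative velocity C t) (at t)"
    unfolding velocity_def by (simp add: vector_derivative_works)
  then show ?thesis
    unfolding planar_lift_def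
    using linear_complex_of_plane
    by (intro bounded_linear.has_vector_derivative[of complex_of_plane])
      (simp_all add: linear_conv_bounded_linear)
qed

lemma planar_lift_continuous: "plane_curve C \<Longrightarrow> continuous_on UNIV (planar_lift C)"
  using planar_lift_has_vector_derivative
  by (meson continuous_at_imp_continuous_on has_vector_derivative_continuous)

section \<open>Chords and coincidences of parameters of a fixed plane curve\<close>

context
  fixes C :: "complex \<Rightarrow> real^2"
  assumes C: "plane_curve C"
begin

text \<open>A coincidence of two circle points is a multiple point, hence transversal with a fibre
  of exactly two points. In particular any further parameter over the same point agrees with
  \<open>u\<close> or \<open>v\<close> up to full turns.\<close>

lemma
  assumes "C (cis u) = C (cis v)" "cis u \<noteq> cis v"
  shows fibre_double_point: "fibre C (C (cis u)) = {cis u, cis v}"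
    and chord_double_point: "{cis u, cis v} \<in> gauss_diagram C"
    and velocities_independent:
      "Im (cnj (complex_of_plane (velocity C u)) * complex_of_plane (velocity C v)) \<noteq> 0"
proof -
  have in_fibre: "cis u \<in> fibre C (C (cis u))" "cis v \<in> fibre C (C (cis u))"
    using assms by (auto simp: fibre_def)
  then have double: "transversal_double_point C (C (cis u))"
    using C assms(2) unfolding plane_curve_def multiple_point_def by blast
  then have "card (fibre C (C (cis u))) = 2" by (simp add: transversal_double_point_def)
  then obtain p q where "fibre C (C (cis u)) = {p, q}" by (auto simp: card_2_iff)
  then show fibre: "fibre C (C (cis u)) = {cis u, cis v}"
    using in_fibre assms(2) by auto
  show "{cis u, cis v} \<in> gauss_diagram C"
    unfolding gauss_diagram_def using double fibre by blast
  have "span {velocity C u, velocity C v} = UNIV"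
    using double in_fibre assms(2) unfolding transversal_double_point_def by blast
  then show "Im (cnj (complex_of_plane (velocity C u)) * complex_of_plane (velocity C v)) \<noteq> 0"
    by (rule Im_cnj_mult_nonzero_if_span)
qed

lemma chord_coincide_cis:
  assumes "{cis u, cis v} \<in> gauss_diagram C"
  shows "C (cis u) = C (cis v)"
proof -
  obtain x where "{cis u, cis v} = fibre C x" using assms by (auto simp: gauss_diagram_def)
  then have "cis u \<in> fibre C x" "cis v \<in> fibre C x" by blast+
  then show ?thesis by (simp add: fibre_def)
qed

text \<open>The window of length 2 pi may start anywhere, so a second chord can be read off starting
  from an endpoint of the first.\<close>

lemma chord_parameters:
  assumes "c \<in> gauss_diagram C"
  obtains p q where "s \<le> p" "p < q" "q < s + 2 * pi" "c = {cis p, cis q}"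
proof -
  obtain x where c: "c = fibre C x" "card c = 2"
    using assms by (auto simp: gauss_diagram_def transversal_double_point_def)
  then obtain y z where yz: "c = {y, z}" "y \<noteq> z" by (auto simp: card_2_iff)
  then have "y \<in> fibre C x" "z \<in> fibre C x" using c(1) by blast+
  then have "norm y = 1" "norm z = 1" by (auto simp: fibre_def)
  then obtain p q where pq: "p \<in> {s..<s + 2 * pi}" "q \<in> {s..<s + 2 * pi}" "y = cis p" "z = cis q"
    using unit_eq_cis_in_period by metis
  with yz(2) consider "p < q" | "q < p" by fastforce
  then show ?thesis
    using that[of p q] that[of q p] pq yz(1) by cases (auto simp: insert_commute)
qed

lemma nondegenerate_coincidence:
  assumes "C (cis (fst z)) = C (cis (snd z))" "cis (fst z) \<noteq> cis (snd z)"
  shows "nondegenerate_at (\<lambda>z. planar_lift C (fst z) - planar_lift C (snd z)) z"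
proof -
  let ?V = "\<lambda>t. complex_of_plane (velocity C t)"
  have deriv: "(planar_lift C has_derivative (\<lambda>h. h *\<^sub>R ?V t)) (at t)" for t
    using planar_lift_has_vector_derivative[OF C] by (simp add: has_vector_derivative_def)
  have "((\<lambda>z. planar_lift C (fst z) - planar_lift C (snd z)) has_derivative
      (\<lambda>h. fst h *\<^sub>R ?V (fst z) - snd h *\<^sub>R ?V (snd z))) (at z)"
    by (intro has_derivative_diff has_derivative_compose[OF _ deriv] derivative_intros)
  moreover have "(\<lambda>h. fst h *\<^sub>R ?V (fst z) - snd h *\<^sub>R ?V (snd z))
      = (\<lambda>(h, k). of_real h * ?V (fst z) + of_real k * (- ?V (snd z)))"
    by (auto simp: scaleR_conv_of_real)
  ultimately show ?thesis
    unfolding nondegenerate_at_def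
    using velocities_independent[OF assms]
    by (intro exI[of _ "?V (fst z)"] exI[of _ "- ?V (snd z)"]) simp
qed

text \<open>The open arcs are disjoint and fit into one period, so an unordered chord determines
  which endpoint lies in which arc, and with it the pair of parameters.\<close>

lemma card_chords_joining_arcs:
  assumes "s < t" "t \<le> p" "p < q" "q \<le> s + 2 * pi"
  shows "card {d \<in> gauss_diagram C. \<exists>u\<in>{s<..<t}. \<exists>v\<in>{p<..<q}. d = {cis u, cis v}}
    = card {z \<in> {s<..<t} \<times> {p<..<q}. planar_lift C (fst z) = planar_lift C (snd z)}"
    (is "card ?D = card ?Z")
proof -
  have inj: "x = y" if "cis x = cis y" "x \<in> {s<..<t} \<union> {p<..<q}" "y \<in> {s<..<t} \<union> {p<..<q}" for x y
    using that assms by (intro cis_inj_within_period) auto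
  have disjoint: "x \<noteq> y" if "x \<in> {s<..<t}" "y \<in> {p<..<q}" for x y
    using that assms by auto
  have "bij_betw (\<lambda>z. {cis (fst z), cis (snd z)}) ?Z ?D"
  proof (rule bij_betw_imageI)
    show "inj_on (\<lambda>z. {cis (fst z), cis (snd z)}) ?Z"
    proof (rule inj_onI)
      fix z w assume z: "z \<in> ?Z" and w: "w \<in> ?Z"
        and eq: "{cis (fst z), cis (snd z)} = {cis (fst w), cis (snd w)}"
      have "cis (fst z) \<noteq> cis (snd w)"
        using inj[of "fst z" "snd w"] disjoint[of "fst z" "snd w"] z w by auto
      then have "cis (fst z) = cis (fst w)" "cis (snd z) = cis (snd w)"
        using eq by (auto simp: doubleton_eq_iff)
      then show "z = w"
        using inj[of "fst z" "fst w"] inj[of "snd z" "snd w"] z w by (auto simp: prod_eq_iff)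
    qed
    show "(\<lambda>z. {cis (fst z), cis (snd z)}) ` ?Z = ?D"
    proof (intro subset_antisym subsetI)
      fix d assume "d \<in> (\<lambda>z. {cis (fst z), cis (snd z)}) ` ?Z"
      then obtain u v where uv: "u \<in> {s<..<t}" "v \<in> {p<..<q}" "C (cis u) = C (cis v)"
          and d: "d = {cis u, cis v}"
        by (auto simp: planar_lift_eq_iff)
      then have "cis u \<noteq> cis v" using inj[of u v] disjoint[of u v] by auto
      then show "d \<in> ?D" using chord_double_point uv d by blast
    next
      fix d assume "d \<in> ?D"
      then show "d \<in> (\<lambda>z. {cis (fst z), cis (snd z)}) ` ?Z"
        using chord_coincide_cis by (force simp: planar_lift_eq_iff image_iff)
    qed
  qed
  then show ?thesis by (simp add: bij_betw_same_card)
qed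

section \<open>The two parity statements\<close>

lemma even_card_crossing_chords:
  assumes "c \<in> gauss_diagram C"
  shows "even (card (crossing_chords (gauss_diagram C) c))"
proof -
  let ?g = "planar_lift C"
  obtain s t where "0 \<le> s" "t < 0 + 2 * pi" and st: "s < t" and c: "c = {cis s, cis t}"
    using chord_parameters[OF assms, of 0] by metis
  then have st: "s < t" "t < s + 2 * pi" by auto
  have same: "C (cis s) = C (cis t)" using assms chord_coincide_cis c by blast
  have "cis s \<noteq> cis t" using cis_inj_within_period[of s t] st by auto
  note fibre = fibre_double_point[OF same this] and indep = velocities_independent[OF same this]
  define \<alpha> where "\<alpha> = complex_of_plane (velocity C s)"
  define \<beta> where "\<beta> = complex_of_plane (velocity C t)"
  \<comment> \<open>The functional is fixed by the values 1 on \<alpha> and -1 on \<beta>; its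
    kernel is the line of \<alpha> + \<beta>. From the base point the loop over
    \<open>{s..t}\<close> departs along \<alpha> and, run backwards, along -\<beta>, both positive
    for \<open>l\<close>; the other loop departs along \<beta> and -\<alpha>, both negative.\<close>
  define l where "l z = - Im (cnj (\<alpha> + \<beta>) * z) / Im (cnj \<alpha> * \<beta>)" for z
  have D: "Im (cnj \<alpha> * \<beta>) \<noteq> 0" using indep by (simp add: \<alpha>_def \<beta>_def)
  have l: "linear l" by (rule linearI) (simp_all add: l_def field_simps add_divide_distrib diff_divide_distrib)
  have "l \<alpha> = 1" "l \<beta> = - 1" using D by (simp_all add: l_def field_simps)
  define f where "f x = l (?g x)" for x
  have f_deriv: "(f has_real_derivative l (complex_of_plane (velocity C x))) (at x)" for x
    unfolding f_def has_real_derivative_iff_has_vector_derivative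
    using l planar_lift_has_vector_derivative[OF C]
    by (intro bounded_linear.has_vector_derivative[of l]) (simp_all add: linear_conv_bounded_linear)
  have ds: "(f has_real_derivative 1) (at s)" and dt: "(f has_real_derivative - 1) (at t)"
    using f_deriv[of s] f_deriv[of t] \<open>l \<alpha> = 1\<close> \<open>l \<beta> = - 1\<close> by (simp_all add: \<alpha>_def \<beta>_def)
  obtain d1 where d1: "d1 > 0" "\<And>h. 0 < h \<Longrightarrow> h < d1 \<Longrightarrow> f s < f (s + h)"
    using DERIV_pos_inc_right[OF ds] by auto
  obtain d2 where d2: "d2 > 0" "\<And>h. 0 < h \<Longrightarrow> h < d2 \<Longrightarrow> f (s - h) < f s"
    using DERIV_pos_inc_left[OF ds] by auto
  obtain d3 where d3: "d3 > 0" "\<And>h. 0 < h \<Longrightarrow> h < d3 \<Longrightarrow> f t < f (t - h)"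
    using DERIV_neg_dec_left[OF dt] by auto
  obtain d4 where d4: "d4 > 0" "\<And>h. 0 < h \<Longrightarrow> h < d4 \<Longrightarrow> f (t + h) < f t"
    using DERIV_neg_dec_right[OF dt] by auto
  \<comment> \<open>Halved so that even \<open>h = e\<close> is strictly below all four
    radii.\<close>
  define e where "e = min (min d1 d2) (min d3 d4) / 2"
  have e: "e > 0" "e < d1" "e < d2" "e < d3" "e < d4"
    using d1(1) d2(1) d3(1) d4(1) by (auto simp: e_def)
  have base: "?g t = ?g s" using same by (simp add: planar_lift_eq_iff)
  \<comment> \<open>The second loop ends at \<open>s + 2 * pi\<close>, and its end is compared with
    the curve just before \<open>s\<close>.\<close>
  have period: "?g (x + 2 * pi) = ?g x" for x
    using cis_add_2pi_int[of x 1] by (simp add: planar_lift_eq_iff)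
  have "even (card {z \<in> {s<..<t} \<times> {t<..<s + 2 * pi}. ?g (fst z) = ?g (snd z)})"
  proof (rule even_card_coincidences_touching_loops)
    show "?g u \<noteq> ?g s" if "u \<in> {s<..<t} \<union> {t<..<s + 2 * pi}" for u
    proof
      assume "?g u = ?g s"
      then have "cis u \<in> fibre C (C (cis s))" by (simp add: planar_lift_eq_iff fibre_def)
      then have "cis u = cis s \<or> cis u = cis t" using fibre by auto
      then show False
        using cis_inj_within_period[of u s] cis_inj_within_period[of u t] that st by auto
    qed
    show "nondegenerate_at (\<lambda>z. ?g (fst z) - ?g (snd z)) z"
      if "z \<in> {s<..<t} \<times> {t<..<s + 2 * pi}" "?g (fst z) = ?g (snd z)" for z
    proof (rule nondegenerate_coincidence)
      show "cis (fst z) \<noteq> cis (snd z)"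
        using cis_inj_within_period[of "fst z" "snd z"] that(1) by auto
    qed (use that in \<open>simp add: planar_lift_eq_iff\<close>)
    show "l (?g (s + h)) > l (?g s) \<and> l (?g (t - h)) > l (?g s) \<and> l (?g (t + h)) < l (?g s)
        \<and> l (?g (s + 2 * pi - h)) < l (?g s)" if "0 < h" "h \<le> e" for h
      using d1(2)[of h] d2(2)[of h] d3(2)[of h] d4(2)[of h] that e base period[of "s - h"]
      by (simp add: f_def algebra_simps)
    show "linear l" by (fact l)
    show "l \<alpha> > 0" using \<open>l \<alpha> = 1\<close> by simp
  qed (use st e base period planar_lift_continuous[OF C] in auto)
  moreover have "crossing_chords (gauss_diagram C) c = {d \<in> gauss_diagram C.
      \<exists>u\<in>{s<..<t}. \<exists>v\<in>{t<..<s + 2 * pi}. d = {cis u, cis v}}"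
    unfolding crossing_chords_def c chords_cross_cis_iff[OF st] Bex_def greaterThanLessThan_iff by blast
  ultimately show ?thesis
    using card_chords_joining_arcs[of s t t "s + 2 * pi"] st by simp
qed

text \<open>The arcs from \<open>s\<close> to \<open>t\<close> and from \<open>p\<close> to
  \<open>q\<close> are disjoint. A chord crossing both given chords needs an endpoint inside each
  arc, and a chord joining the arcs crosses both; so the chords counted are the intersections of two
  loops with different base points.\<close>

lemma even_card_crossing_both_arcs:
  assumes st: "s < t" "t < p" "p < q" "q < s + 2 * pi"
    and ab: "{cis s, cis t} \<in> gauss_diagram C" "{cis p, cis q} \<in> gauss_diagram C"
  shows "even (card (crossing_chords (gauss_diagram C) {cis s, cis t}
                   \<inter> crossing_chords (gauss_diagram C) {cis p, cis q}))"
proof -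
  let ?g = "planar_lift C"
  have same: "C (cis s) = C (cis t)" "C (cis p) = C (cis q)"
    using ab chord_coincide_cis by blast+
  have inj: "x = y" if "cis x = cis y" "x \<in> {s..<s + 2 * pi}" "y \<in> {s..<s + 2 * pi}" for x y
    using that by (intro cis_inj_within_period) auto
  have "cis s \<noteq> cis t" "cis p \<noteq> cis q" using inj[of s t] inj[of p q] st by auto
  note fibre = fibre_double_point[OF same(1) this(1)] fibre_double_point[OF same(2) this(2)]
  have "even (card {z \<in> {s<..<t} \<times> {p<..<q}. ?g (fst z) = ?g (snd z)})"
  proof (rule even_card_coincidences_disjoint_base)
    show "?g u \<noteq> ?g p" if "u \<in> {s..t}" for u
    proof
      assume "?g u = ?g p"
      then have "cis u \<in> fibre C (C (cis p))" by (simp add: planar_lift_eq_iff fibre_def)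
      then have "cis u = cis p \<or> cis u = cis q" using fibre by auto
      then show False using inj[of u p] inj[of u q] that st by auto
    qed
    show "?g v \<noteq> ?g s" if "v \<in> {p..q}" for v
    proof
      assume "?g v = ?g s"
      then have "cis v \<in> fibre C (C (cis s))" by (simp add: planar_lift_eq_iff fibre_def)
      then have "cis v = cis s \<or> cis v = cis t" using fibre by auto
      then show False using inj[of v s] inj[of v t] that st by auto
    qed
    show "nondegenerate_at (\<lambda>z. ?g (fst z) - ?g (snd z)) z"
      if "z \<in> {s<..<t} \<times> {p<..<q}" "?g (fst z) = ?g (snd z)" for z
    proof (rule nondegenerate_coincidence)
      show "cis (fst z) \<noteq> cis (snd z)"
        using inj[of "fst z" "snd z"] that(1) st by auto
    qed (use that in \<open>simp add: planar_lift_eq_iff\<close>)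
  qed (use st same planar_lift_continuous[OF C] in \<open>auto simp: planar_lift_eq_iff\<close>)
  moreover have "crossing_chords (gauss_diagram C) {cis s, cis t}
      \<inter> crossing_chords (gauss_diagram C) {cis p, cis q}
    = {d \<in> gauss_diagram C. \<exists>u\<in>{s<..<t}. \<exists>v\<in>{p<..<q}. d = {cis u, cis v}}" (is "?I = ?D")
  proof (intro subset_antisym subsetI)
    fix d assume "d \<in> ?I"
    then have d: "d \<in> gauss_diagram C" "chords_cross {cis s, cis t} d" "chords_cross {cis p, cis q} d"
      by (auto simp: crossing_chords_def)
    have "t < s + 2 * pi" "q < p + 2 * pi" using st by auto
    then obtain u v u' v' where u: "s < u" "u < t" "t < v" "v < s + 2 * pi" "d = {cis u, cis v}"
      and u': "p < u'" "u' < q" "d = {cis u', cis v'}"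
      using d(2,3) chords_cross_cis_iff[of s t d] chords_cross_cis_iff[of p q d] st(1,3) by blast
    have "cis u' = cis u \<or> cis u' = cis v" using u u' by (metis doubleton_eq_iff)
    moreover have "cis u' \<noteq> cis u" using inj[of u' u] u u' st by auto
    ultimately have "u' = v" using inj[of u' v] u u' st by auto
    then have "u \<in> {s<..<t}" "v \<in> {p<..<q}" using u u' by auto
    then show "d \<in> ?D" using d(1) u(5) by blast
  next
    fix d assume "d \<in> ?D"
    then obtain u v where d: "d \<in> gauss_diagram C" "s < u" "u < t" "p < v" "v < q" "d = {cis u, cis v}"
      by auto
    have "v < s + 2 * pi" "t < v" "t < s + 2 * pi" using d st by auto
    then have "chords_cross {cis s, cis t} d"
      using d st(1) chords_cross_cis_iff[of s t d] by blast
    \<comment> \<open>Going round from \<open>p\<close>, the endpoint \<open>cis u\<close> is met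
      only after \<open>q\<close>, at the parameter one turn later.\<close>
    moreover have "d = {cis v, cis (u + 2 * pi)}"
      using d(6) cis_add_2pi_int[of u 1] by auto
    moreover have "q < u + 2 * pi" "u + 2 * pi < p + 2 * pi" "q < p + 2 * pi" using d st by auto
    ultimately have "chords_cross {cis s, cis t} d" "chords_cross {cis p, cis q} d"
      using d(4,5) st(3) chords_cross_cis_iff[of p q d] by blast+
    then show "d \<in> ?I" using d(1) by (simp add: crossing_chords_def)
  qed
  ultimately show ?thesis
    using card_chords_joining_arcs[of s t p q] st by simp
qed

text \<open>Distinct chords are fibres over different points and share no endpoint. Without
  crossing, the arc from \<open>p\<close> to \<open>q\<close> either follows the arc from
  \<open>s\<close> to \<open>t\<close> or is nested in it; in the nested case the complementary arc,
  from \<open>t\<close> to \<open>s + 2 * pi\<close>, represents \<open>a\<close> instead.\<close>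

lemma even_card_crossing_both:
  assumes a: "a \<in> gauss_diagram C" and b: "b \<in> gauss_diagram C"
    and "a \<noteq> b" "\<not> chords_cross a b"
  shows "even (card (crossing_chords (gauss_diagram C) a \<inter> crossing_chords (gauss_diagram C) b))"
proof -
  obtain s t where "0 \<le> s" "t < 0 + 2 * pi" and "s < t" and a_eq: "a = {cis s, cis t}"
    using chord_parameters[OF a, of 0] by metis
  then have st: "s < t" "t < s + 2 * pi" by auto
  obtain p q where pq: "s \<le> p" "p < q" "q < s + 2 * pi" and b_eq: "b = {cis p, cis q}"
    using chord_parameters[OF b] .
  have "a \<inter> b = {}"
    using a b assms(3) by (auto simp: gauss_diagram_def fibre_def)
  then have ends: "p \<noteq> s" "p \<noteq> t" "q \<noteq> t" using a_eq b_eq by auto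
  have "\<not> (p < t \<and> t < q)"
    using assms(4) pq ends unfolding a_eq b_eq chords_cross_cis_iff[OF st]
    by (metis order_le_less)
  then consider "t < p" | "q < t" using pq(2) ends by linarith
  then show ?thesis
  proof cases
    case 1
    then show ?thesis
      using even_card_crossing_both_arcs[of s t p q] st pq a b unfolding a_eq b_eq by simp
  next
    case 2
    have "a = {cis t, cis (s + 2 * pi)}" using cis_add_2pi_int[of s 1] a_eq by auto
    then show ?thesis
      using even_card_crossing_both_arcs[of p q t "s + 2 * pi"] 2 st pq ends a b b_eq
      by (simp add: Int_commute)
  qed
qed

end

theorem proposition3p1:
  fixes C :: "complex \<Rightarrow> real^2" and G :: "complex set set"
  assumes "plane_curve C"
    and "G = gauss_diagram C"
    and "\<forall>c\<in>G. crossing_chords G c \<noteq> {}"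
  shows "(\<forall>a\<in>G. \<forall>b\<in>G. a \<noteq> b \<longrightarrow> \<not> chords_cross a b \<longrightarrow>
            even (card (crossing_chords G a \<inter> crossing_chords G b)))
       \<and> (\<forall>c\<in>G. even (card (crossing_chords G c)))"
  using even_card_crossing_both[OF assms(1)] even_card_crossing_chords[OF assms(1)]
  unfolding assms(2) by blast

end
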